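(* Suppose Assumptions 1 and 3 hold, $\boldsymbol{x}\notin\mathcal{Z}$, and $\boldsymbol{y}^*=(\boldsymbol{u}^*,\rho^* )$ is the unique solution of $\boldsymbol{F}(\boldsymbol{y})=\boldsymbol{0}$ with $\rho^*>0$. Consider the following iteration (high-dimensional semismooth Newton method) with parameters $\sigma,\beta\in(0,1)$, started at $\boldsymbol{y}^0=(\boldsymbol{u}^0,\rho^0)$ with $\nabla L(\boldsymbol{u}^0)\neq\boldsymbol{0}$: at iteration $k$, choose $J^k\in\mathcal{J}_{\boldsymbol{F}}(\boldsymbol{y}^k)$ and compute $\boldsymbol{d}^k=(\boldsymbol{d}_1^k,d_2^k)$ with $J^k\boldsymbol{d}^k=-\boldsymbol{F}(\boldsymbol{y}^k)$; set $\alpha=1$; while $\max_i\{u_i^k+\alpha(d_1^k)_i\}\le a$, set $\alpha\leftarrow\beta\alpha$; then while $\|\boldsymbol{F}(\boldsymbol{y}^k+\alpha\boldsymbol{d}^k)\|>(1-\sigma\alpha)\|\boldsymbol{F}(\boldsymbol{y}^k)\|$, set $\alpha\leftarrow\beta\alpha$; finally $\boldsymbol{y}^{k+1}=\boldsymbol{y}^k+\alpha\boldsymbol{d}^k$. Then there exists $\delta>0$ such that for every $\boldsymbol{y}^0$ in the ball $\mathcal{N}(\boldsymbol{y}^*,\delta)$ the sequence $\{\boldsymbol{y}^k\}$ is well defined, the accepted step size is always $\alpha=1$, and $\boldsymbol{y}^k\to\boldsymbol{y}^*$ Q-superlinearly. If moreover $\boldsymbol{F}$ is strongly semismooth, the convergence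 is quadratic.
   Context: Assumption 1: $l:\mathbb{R}\to\mathbb{R}$ is nondecreasing and convex, and $\inf_x l(x)<\lambda$. Assumption 3: $l$ is differentiable and nonconstant, and $l'$ is semismooth with respect to its Clarke subdifferential $\partial l'$. $\mathcal{Z}=\{\boldsymbol{z}\in\mathbb{R}^m:\frac1m\sum_i l(z_i)\le\lambda\}$. $L(\boldsymbol{u})=\sum_{i=1}^m l(u_i)$, $\nabla L(\boldsymbol{u})=(l'(u_i))_i$, $\partial\nabla L(\boldsymbol{u})=\{\mathrm{diag}(\eta_1,\dots,\eta_m):\eta_i\in\partial l'(u_i)\}$. For $\boldsymbol{y}=(\boldsymbol{u},\rho)$: $\boldsymbol{F}(\boldsymbol{y})=\big(\boldsymbol{u}-\boldsymbol{x}+\frac{\rho}{m}\nabla L(\boldsymbol{u}),\ \frac1mL(\boldsymbol{u})-\lambda\big)$ and $\mathcal{J}_{\boldsymbol{F}}(\boldsymbol{y})=\Big\{\begin{bmatrix}\mathbf{I}+\frac{\rho}{m}\Lambda & \frac1m\nabla L(\boldsymbol{u})\\ \frac1m\nabla L(\boldsymbol{u})^\top & 0\end{bmatrix}:\Lambda\in\partial\nabla L(\boldsymbol{u})\Big\}$; $\boldsymbol{F}$ is semismooth with respect to $\mathcal{J}_{\boldsymbol{F}}$. The threshold $a$ is $-\infty$ if $l'(u)>0$ for all $u$, and $a=\sup\{u:l'(u)=0\}$ otherwise. *)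

theory Defs
  imports "HOL-Analysis.Analysis"
begin

definition clarke_subdiff :: "(real \<Rightarrow> real) \<Rightarrow> real \<Rightarrow> real set" where
  "clarke_subdiff g x = convex hull {v. \<exists>s::nat \<Rightarrow> real. (\<forall>k. g differentiable (at (s k)))
       \<and> s \<longlonglongrightarrow> x \<and> (\<lambda>k. deriv g (s k)) \<longlonglongrightarrow> v}"

definition semismooth_wrt :: "('a::euclidean_space \<Rightarrow> 'b::euclidean_space) \<Rightarrow> ('a \<Rightarrow> ('a \<Rightarrow> 'b) set) \<Rightarrow> 'a \<Rightarrow> bool" where
  "semismooth_wrt F K x \<longleftrightarrow>
     (\<exists>U C. open U \<and> x \<in> U \<and> C-lipschitz_on U F) \<and>
     (\<forall>h. \<exists>D. ((\<lambda>t. (F (x + t *\<^sub>R h) - F x) /\<^sub>R t) \<longlongrightarrow> D) (at_right 0)) \<and>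
     (\<forall>\<epsilon>>0. \<exists>\<delta>>0. \<forall>h V. norm h < \<delta> \<and> V \<in> K (x + h) \<longrightarrow>
          norm (F (x + h) - F x - V h) \<le> \<epsilon> * norm h)"

definition strongly_semismooth_wrt :: "('a::euclidean_space \<Rightarrow> 'b::euclidean_space) \<Rightarrow> ('a \<Rightarrow> ('a \<Rightarrow> 'b) set) \<Rightarrow> 'a \<Rightarrow> bool" where
  "strongly_semismooth_wrt F K x \<longleftrightarrow>
     (\<exists>U C. open U \<and> x \<in> U \<and> C-lipschitz_on U F) \<and>
     (\<forall>h. \<exists>D. ((\<lambda>t. (F (x + t *\<^sub>R h) - F x) /\<^sub>R t) \<longlongrightarrow> D) (at_right 0)) \<and>
     (\<exists>C \<delta>. \<delta> > 0 \<and> (\<forall>h V. norm h < \<delta> \<and> V \<in> K (x + h) \<longrightarrow>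
          norm (F (x + h) - F x - V h) \<le> C * (norm h)\<^sup>2))"

definition clarke_maps :: "(real \<Rightarrow> real) \<Rightarrow> real \<Rightarrow> (real \<Rightarrow> real) set" where
  "clarke_maps g x = (\<lambda>\<eta>. \<lambda>h. \<eta> * h) ` clarke_subdiff g x"

definition Zset :: "(real \<Rightarrow> real) \<Rightarrow> real \<Rightarrow> (real ^ 'm) set" where
  "Zset l lam = {z. (\<Sum>i\<in>UNIV. l (z $ i)) / real CARD('m) \<le> lam}"

definition Lsum :: "(real \<Rightarrow> real) \<Rightarrow> real ^ 'm \<Rightarrow> real" where
  "Lsum l u = (\<Sum>i\<in>UNIV. l (u $ i))"

definition gradL :: "(real \<Rightarrow> real) \<Rightarrow> real ^ 'm \<Rightarrow> real ^ 'm" where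
  "gradL l u = (\<chi> i. deriv l (u $ i))"

definition Fmap :: "(real \<Rightarrow> real) \<Rightarrow> real \<Rightarrow> real ^ 'm \<Rightarrow> (real ^ 'm) \<times> real \<Rightarrow> (real ^ 'm) \<times> real" where
  "Fmap l lam x y = (fst y - x + (snd y / real CARD('m)) *\<^sub>R gradL l (fst y),
                     Lsum l (fst y) / real CARD('m) - lam)"

definition JF :: "(real \<Rightarrow> real) \<Rightarrow> (real ^ 'm) \<times> real \<Rightarrow> ((real ^ 'm) \<times> real \<Rightarrow> (real ^ 'm) \<times> real) set" where
  "JF l y = {(\<lambda>d. (fst d + (snd y / real CARD('m)) *\<^sub>R (\<chi> i. \<eta> i * fst d $ i)
                       + (snd d / real CARD('m)) *\<^sub>R gradL l (fst y),
                    (gradL l (fst y) \<bullet> fst d) / real CARD('m)))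
             | \<eta>. \<forall>i. \<eta> i \<in> clarke_subdiff (deriv l) (fst y $ i)}"

definition a_thr :: "(real \<Rightarrow> real) \<Rightarrow> ereal" where
  "a_thr l = (if \<forall>u. deriv l u > 0 then -\<infinity> else ereal (Sup {u. deriv l u = 0}))"

text \<open>One iteration of the semismooth Newton method from y using the chosen J \<in> J_F(y):
  ssn_step ... J y j y' holds iff J is nonsingular, both backtracking loops terminate,
  the accepted step size is beta^j, and y' = y + beta^j d.\<close>
definition ssn_step :: "real \<Rightarrow> real \<Rightarrow> ereal \<Rightarrow> ((real ^ 'm) \<times> real \<Rightarrow> (real ^ 'm) \<times> real)
    \<Rightarrow> ((real ^ 'm) \<times> real \<Rightarrow> (real ^ 'm) \<times> real) \<Rightarrow> (real ^ 'm) \<times> real \<Rightarrow> nat \<Rightarrow> (real ^ 'm) \<times> real \<Rightarrow> bool" where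
  "ssn_step \<sigma> \<beta> a F J y j y' \<longleftrightarrow> bij J \<and>
     (let d = inv J (- F y);
          ok1 = (\<lambda>j::nat. \<not> (ereal (Max (range (\<lambda>i. (fst y + (\<beta> ^ j) *\<^sub>R fst d) $ i))) \<le> a));
          j1 = (LEAST j. ok1 j);
          ok2 = (\<lambda>j::nat. norm (F (y + (\<beta> ^ j) *\<^sub>R d)) \<le> (1 - \<sigma> * \<beta> ^ j) * norm (F y))
      in (\<exists>j. ok1 j) \<and> (\<exists>j\<ge>j1. ok2 j) \<and> j = (LEAST j. j1 \<le> j \<and> ok2 j) \<and> y' = y + (\<beta> ^ j) *\<^sub>R d)"

definition ssn_seq :: "real \<Rightarrow> real \<Rightarrow> (real \<Rightarrow> real) \<Rightarrow> real \<Rightarrow> real ^ 'm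
    \<Rightarrow> (nat \<Rightarrow> (real ^ 'm) \<times> real) \<Rightarrow> (nat \<Rightarrow> ((real ^ 'm) \<times> real \<Rightarrow> (real ^ 'm) \<times> real)) \<Rightarrow> nat \<Rightarrow> bool" where
  "ssn_seq \<sigma> \<beta> l lam x y J n \<longleftrightarrow> (\<forall>k<n. J k \<in> JF l (y k) \<and>
       (\<exists>j. ssn_step \<sigma> \<beta> (a_thr l) (Fmap l lam x) (J k) (y k) j (y (Suc k))))"

end

theory Submission
  imports Defs
begin

text \<open>At the solution \<open>\<nabla>L(u\<^sup>*) \<noteq> 0\<close>, since otherwise \<open>u\<^sup>* = x\<close> would lie in \<open>Z\<close>. Near it, every element
  of \<open>J\<^sub>F\<close> is a bordered matrix with diagonal block between \<open>I\<close> and a fixed multiple of \<open>I\<close> and with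
  border bounded away from zero, so these matrices have uniformly bounded inverses. Semismoothness of
  \<open>l'\<close> gives \<open>F y - J (y - y\<^sup>*) = o(\<parallel>y - y\<^sup>*\<parallel>)\<close> uniformly in \<open>J\<close>, so the full Newton step maps \<open>y\<close> to a
  point at distance \<open>o(\<parallel>y - y\<^sup>*\<parallel>)\<close> from \<open>y\<^sup>*\<close>. As \<open>\<parallel>F y\<parallel>\<close> and \<open>\<parallel>y - y\<^sup>*\<parallel>\<close> are comparable near \<open>y\<^sup>*\<close>, the
  full step passes both line searches.

  That \<open>J\<^sub>F\<close> has an element at all rests on \<open>\<partial>l'(t) \<noteq> {}\<close>. This needs no Rademacher theorem: \<open>l'\<close> has
  one-sided derivatives everywhere, and these can differ only at a strict local minimum of
  \<open>\<plusminus>l' - r\<cdot>id\<close> for some rational \<open>r\<close>, hence only at countably many points.\<close>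

section \<open>One-sided derivatives and points of non-differentiability\<close>

text \<open>Each strict local minimum is the strict minimum over some open interval with rational
  endpoints. Two such points in one interval would each have the smaller value, so an interval
  serves at most one point, and there are countably many intervals.\<close>

lemma countable_strict_local_minima:
  fixes f :: "real \<Rightarrow> real"
  shows "countable {x. \<exists>e>0. \<forall>y. y \<noteq> x \<and> \<bar>y - x\<bar> < e \<longrightarrow> f x < f y}" (is "countable ?S")
proof -
  define I where "I p = {x. fst p < x \<and> x < snd p \<and> (\<forall>y. y \<noteq> x \<and> fst p < y \<and> y < snd p \<longrightarrow> f x < f y)}"
    for p :: "real \<times> real"
  have sub: "?S \<subseteq> (\<Union>p\<in>\<rat>\<times>\<rat>. I p)"
  proof
    fix x assume "x \<in> ?S"
    then obtain e where e: "e > 0" "\<And>y. y \<noteq> x \<Longrightarrow> \<bar>y - x\<bar> < e \<Longrightarrow> f x < f y" by auto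
    obtain a where a: "a \<in> \<rat>" "x - e < a" "a < x" using Rats_dense_in_real[of "x - e" x] e by auto
    obtain b where b: "b \<in> \<rat>" "x < b" "b < x + e" using Rats_dense_in_real[of x "x + e"] e by auto
    have "x \<in> I (a, b)" using a b e by (auto simp: I_def)
    then show "x \<in> (\<Union>p\<in>\<rat>\<times>\<rat>. I p)" using a b by blast
  qed
  have "countable (I p)" for p
  proof -
    have "x = y" if "x \<in> I p" "y \<in> I p" for x y
    proof (rule ccontr)
      assume "x \<noteq> y"
      then have "f x < f y" "f y < f x" using that by (auto simp: I_def)
      then show False by simp
    qed
    then have "I p = {} \<or> (\<exists>x. I p = {x})" by blast
    then show ?thesis by auto
  qed
  then have "countable (\<Union>p\<in>\<rat>\<times>\<rat>. I p)" using countable_rat by (intro countable_UN) auto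
  then show ?thesis using sub countable_subset by blast
qed

text \<open>\<open>E\<close> is the slope in direction -1, so the left derivative is
  \<open>- E\<close> and the hypotheses say \<open>- E < r < D\<close>. A line of slope
  \<open>r\<close> through a convex kink lies strictly below the graph on both sides. The number
  \<open>r\<close> is kept free so that it can later be taken rational.\<close>

lemma strict_local_min_of_one_sided_slopes:
  fixes f :: "real \<Rightarrow> real"
  assumes R: "((\<lambda>t. (f (x + t) - f x) / t) \<longlongrightarrow> D) (at_right 0)" "r < D"
    and L: "((\<lambda>t. (f (x - t) - f x) / t) \<longlongrightarrow> E) (at_right 0)" "- r < E"
  shows "\<exists>e>0. \<forall>y. y \<noteq> x \<and> \<bar>y - x\<bar> < e \<longrightarrow> f x - r * x < f y - r * y"
proof -
  have "\<forall>\<^sub>F t in at_right 0. r < (f (x + t) - f x) / t" using order_tendstoD(1)[OF R] .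
  moreover have "\<forall>\<^sub>F t in at_right 0. - r < (f (x - t) - f x) / t" using order_tendstoD(1)[OF L] .
  ultimately have "\<forall>\<^sub>F t in at_right 0. r < (f (x + t) - f x) / t \<and> - r < (f (x - t) - f x) / t"
    by (rule eventually_conj)
  then obtain e where e: "e > 0" and
    *: "\<And>t. 0 < t \<Longrightarrow> t < e \<Longrightarrow> r < (f (x + t) - f x) / t \<and> - r < (f (x - t) - f x) / t"
    unfolding eventually_at_right_field by auto
  have "f x - r * x < f y - r * y" if y: "y \<noteq> x" "\<bar>y - x\<bar> < e" for y
  proof (cases "y > x")
    case True
    then have "r < (f y - f x) / (y - x)" using *[of "y - x"] y by auto
    then show ?thesis using True by (simp add: field_simps)
  next
    case False
    then have "- r < (f y - f x) / (x - y)" using *[of "x - y"] y by auto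
    then show ?thesis using False y by (simp add: field_simps)
  qed
  then show ?thesis using e by blast
qed

lemma countable_not_differentiable_if_one_sided:
  fixes f :: "real \<Rightarrow> real"
  assumes dir: "\<And>x h. \<exists>D. ((\<lambda>t. (f (x + t *\<^sub>R h) - f x) /\<^sub>R t) \<longlongrightarrow> D) (at_right 0)"
  shows "countable {x. \<not> f differentiable (at x)}"
proof -
  define M where "M g = {x. \<exists>e>0. \<forall>y. y \<noteq> x \<and> \<bar>y - x\<bar> < e \<longrightarrow> g x < g y}" for g :: "real \<Rightarrow> real"
  have "{x. \<not> f differentiable (at x)} \<subseteq> (\<Union>r\<in>\<rat>. M (\<lambda>y. f y - r * y) \<union> M (\<lambda>y. - f y - r * y))"
  proof
    fix x assume "x \<in> {x. \<not> f differentiable (at x)}"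
    then have nd: "\<not> f differentiable (at x)" by simp
    obtain D where D: "((\<lambda>t. (f (x + t) - f x) / t) \<longlongrightarrow> D) (at_right 0)"
      using dir[of x 1] by (auto simp: divide_inverse mult.commute)
    obtain E where E: "((\<lambda>t. (f (x - t) - f x) / t) \<longlongrightarrow> E) (at_right 0)"
      using dir[of x "-1"] by (auto simp: divide_inverse mult.commute)
    \<comment> \<open>Reflecting \<open>t\<close> to \<open>- t\<close> turns the limit
      \<open>E\<close> into the left limit \<open>- E\<close> of the same difference quotient, so
      equality would give a two-sided derivative.\<close>
    have "D \<noteq> - E"
    proof
      assume DE: "D = - E"
      have "((\<lambda>t. (f (x + t) - f x) / t) \<longlongrightarrow> D) (at_left 0)"
        using tendsto_minus[OF E] unfolding DE
        by (subst at_left_minus, simp add: filterlim_filtermap)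
      then have "((\<lambda>t. (f (x + t) - f x) / t) \<longlongrightarrow> D) (at 0)"
        using D filterlim_split_at by blast
      then show False using nd by (auto simp: DERIV_def real_differentiable_def)
    qed
    then consider "- E < D" | "D < - E" by linarith
    then show "x \<in> (\<Union>r\<in>\<rat>. M (\<lambda>y. f y - r * y) \<union> M (\<lambda>y. - f y - r * y))"
    proof cases
      case 1
      then obtain r where r: "r \<in> \<rat>" "- E < r" "r < D" using Rats_dense_in_real by blast
      have "x \<in> M (\<lambda>y. f y - r * y)"
        unfolding M_def using strict_local_min_of_one_sided_slopes[OF D _ E, of r] r by simp
      then show ?thesis using r by blast
    next
      \<comment> \<open>A concave kink of \<open>f\<close> is a convex kink of \<open>- f\<close>,
        whose slopes are \<open>- D\<close> and \<open>- E\<close>.\<close>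
      case 2
      then have "E < - D" by simp
      then obtain r where r: "r \<in> \<rat>" "E < r" "r < - D" using Rats_dense_in_real by blast
      have D': "((\<lambda>t. (- f (x + t) - - f x) / t) \<longlongrightarrow> - D) (at_right 0)"
        using tendsto_minus[OF D] by (simp add: diff_divide_distrib)
      have E': "((\<lambda>t. (- f (x - t) - - f x) / t) \<longlongrightarrow> - E) (at_right 0)"
        using tendsto_minus[OF E] by (simp add: diff_divide_distrib)
      have "x \<in> M (\<lambda>y. - f y - r * y)"
        unfolding M_def using strict_local_min_of_one_sided_slopes[OF D' _ E', of r] r by simp
      then show ?thesis using r by blast
    qed
  qed
  moreover have "countable (\<Union>r\<in>\<rat>. M (\<lambda>y. f y - r * y) \<union> M (\<lambda>y. - f y - r * y))"
    unfolding M_def using countable_rat countable_strict_local_minima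
    by (intro countable_UN countable_Un) auto
  ultimately show ?thesis using countable_subset by blast
qed

section \<open>Clarke subdifferential of a monotone, locally Lipschitz function\<close>

text \<open>Both bounds are monotonicity statements: \<open>g\<close> is nondecreasing, and by the
  Lipschitz condition so is \<open>C * s - g s\<close> on \<open>U\<close>.\<close>

lemma deriv_bounds_mono_lipschitz:
  fixes g :: "real \<Rightarrow> real"
  assumes mono: "mono g" and lip: "C-lipschitz_on U g" and U: "open U" "t \<in> U"
    and diff: "g differentiable (at t)"
  shows "0 \<le> deriv g t \<and> deriv g t \<le> C"
proof -
  have D: "(g has_real_derivative deriv g t) (at t)"
    using diff by (simp add: DERIV_deriv_iff_real_differentiable)
  have "deriv g t \<ge> 0"
    using mono_on_imp_deriv_nonneg[of UNIV g "deriv g t" t] mono D by (simp add: mono_on_def monoD)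
  moreover have "0 \<le> C - deriv g t"
  proof (rule mono_on_imp_deriv_nonneg[of U "\<lambda>s. C * s - g s"])
    show "mono_on U (\<lambda>s. C * s - g s)"
    proof (rule mono_onI)
      fix r s assume rs: "r \<in> U" "s \<in> U" "r \<le> s"
      then have "dist (g s) (g r) \<le> C * dist s r" using lipschitz_onD[OF lip] by blast
      then show "C * r - g r \<le> C * s - g s" using rs by (simp add: dist_real_def algebra_simps)
    qed
    show "((\<lambda>s. C * s - g s) has_real_derivative C - deriv g t) (at t)"
      by (auto intro!: derivative_eq_intros D)
  qed (use U in \<open>simp add: interior_open\<close>)
  ultimately show ?thesis by simp
qed

text \<open>The interval is convex, so only the generating limits matter; it is closed, so it
  suffices to bound the derivatives near \<open>t\<close>.\<close>

lemma clarke_subdiff_mono_lipschitz: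
  fixes g :: "real \<Rightarrow> real"
  assumes mono: "mono g" and lip: "C-lipschitz_on U g" and U: "open U" "t \<in> U"
  shows "clarke_subdiff g t \<subseteq> {0..C}"
  unfolding clarke_subdiff_def
proof (rule hull_minimal)
  show "{v. \<exists>s::nat \<Rightarrow> real. (\<forall>k. g differentiable (at (s k))) \<and> s \<longlonglongrightarrow> t \<and> (\<lambda>k. deriv g (s k)) \<longlonglongrightarrow> v} \<subseteq> {0..C}"
  proof clarify
    fix v and s :: "nat \<Rightarrow> real"
    assume s: "\<forall>k. g differentiable (at (s k))" "s \<longlonglongrightarrow> t" "(\<lambda>k. deriv g (s k)) \<longlonglongrightarrow> v"
    have "\<forall>\<^sub>F k in sequentially. s k \<in> U" using topological_tendstoD[OF s(2) U] .
    then have ev: "\<forall>\<^sub>F k in sequentially. deriv g (s k) \<in> {0..C}"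
      by eventually_elim (use deriv_bounds_mono_lipschitz[OF mono lip U(1)] s(1) in auto)
    show "v \<in> {0..C}"
      by (rule Lim_in_closed_set[OF closed_atLeastAtMost ev _ s(3)]) simp
  qed
qed simp

text \<open>A nonempty open set is not covered by a countable one, so points of differentiability
  accumulate at \<open>t\<close>. Their derivatives lie in the compact interval
  \<open>{0..C}\<close>, and a convergent subsequence supplies an element.\<close>

lemma clarke_subdiff_nonempty:
  fixes g :: "real \<Rightarrow> real"
  assumes mono: "mono g" and lip: "C-lipschitz_on U g" and U: "open U" "t \<in> U"
    and count: "countable {x. \<not> g differentiable (at x)}"
  shows "clarke_subdiff g t \<noteq> {}"
proof -
  have "\<exists>s. g differentiable (at s) \<and> s \<in> U \<and> dist s t < inverse (real (Suc k))" for k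
  proof (rule ccontr)
    assume "\<nexists>s. g differentiable (at s) \<and> s \<in> U \<and> dist s t < inverse (real (Suc k))"
    then have sub: "U \<inter> ball t (inverse (real (Suc k))) \<subseteq> {x. \<not> g differentiable (at x)}"
      by (auto simp: dist_commute)
    have "open (U \<inter> ball t (inverse (real (Suc k))))" "t \<in> U \<inter> ball t (inverse (real (Suc k)))"
      using U by auto
    then obtain s where "s \<in> U \<inter> ball t (inverse (real (Suc k)))" "s \<notin> {x. \<not> g differentiable (at x)}"
      using open_minus_countable[OF count] by (metis empty_iff)
    then show False using sub by blast
  qed
  then obtain s where s: "\<And>k. g differentiable (at (s k))" "\<And>k. s k \<in> U"
    "\<And>k. dist (s k) t < inverse (real (Suc k))" by metis
  have "s \<longlonglongrightarrow> t"
    unfolding tendsto_dist_iff[of s]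
    by (rule tendsto_sandwich[OF _ _ tendsto_const LIMSEQ_inverse_real_of_nat])
      (use s(3) in \<open>auto intro: less_imp_le always_eventually\<close>)
  have "deriv g (s k) \<in> {0..C}" for k
    using deriv_bounds_mono_lipschitz[OF mono lip U(1) s(2) s(1)] by auto
  then obtain v r where r: "strict_mono (r :: nat \<Rightarrow> nat)" "((\<lambda>k. deriv g (s k)) \<circ> r) \<longlonglongrightarrow> v"
    using compact_imp_seq_compact[OF compact_Icc, of 0 C] by (metis seq_compactE)
  have "v \<in> {v. \<exists>s::nat \<Rightarrow> real. (\<forall>k. g differentiable (at (s k))) \<and> s \<longlonglongrightarrow> t \<and> (\<lambda>k. deriv g (s k)) \<longlonglongrightarrow> v}"
    using s(1) LIMSEQ_subseq_LIMSEQ[OF \<open>s \<longlonglongrightarrow> t\<close> r(1)] r(2)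
    by (auto simp: o_def intro!: exI[of _ "\<lambda>k. s (r k)"])
  then have "v \<in> clarke_subdiff g t" unfolding clarke_subdiff_def by (rule hull_inc)
  then show ?thesis by auto
qed

section \<open>Bordered matrices and bounds for their inverses\<close>

text \<open>The symmetric saddle-point matrix with diagonal block \<open>I + diag w\<close>, border
  \<open>q\<close> and corner 0, written as a map.\<close>

definition bordered :: "('m \<Rightarrow> real) \<Rightarrow> real ^ 'm \<Rightarrow> (real ^ 'm) \<times> real \<Rightarrow> (real ^ 'm) \<times> real" where
  "bordered w q d = ((\<chi> i. (1 + w i) * fst d $ i) + snd d *\<^sub>R q, q \<bullet> fst d)"

lemma linear_bordered: "linear (bordered w q)"
  by (rule linearI) (auto simp: bordered_def vec_eq_iff algebra_simps inner_add_right)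

lemma norm_fst_add_snd: "norm (d :: 'a::real_normed_vector \<times> 'b::real_normed_vector) \<le> norm (fst d) + norm (snd d)"
  by (metis norm_Pair_le prod.collapse)

lemma norm_diagonal_le:
  fixes v :: "real ^ 'm"
  assumes "\<And>i. \<bar>w i\<bar> \<le> M"
  shows "norm (\<chi> i. w i * v $ i) \<le> M * norm v"
proof -
  have M: "M \<ge> 0" using assms abs_ge_zero order_trans by blast
  have "norm (\<chi> i. w i * v $ i) \<le> norm (M *\<^sub>R v)"
    by (rule norm_le_componentwise_cart) (use assms M in \<open>simp add: abs_mult mult_right_mono\<close>)
  then show ?thesis using M by simp
qed

text \<open>The diagonal block contributes \<open>1 + M\<close> and each copy of the border
  \<open>Q\<close>. This is the bound that later controls the residual by the distance to the
  solution.\<close>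

lemma bordered_norm_le:
  assumes w: "\<And>i. 0 \<le> w i \<and> w i \<le> M" and q: "norm q \<le> Q"
  shows "norm (bordered w q d) \<le> (1 + M + 2 * Q) * norm d"
proof -
  have Q: "Q \<ge> 0" using q norm_ge_zero order_trans by blast
  have M: "M \<ge> 0" using w order_trans by blast
  have f: "norm (fst d) \<le> norm d" and s: "norm (snd d) \<le> norm d"
    by (metis norm_fst_le prod.collapse, metis norm_snd_le prod.collapse)
  have "norm (\<chi> i. (1 + w i) * fst d $ i) \<le> (1 + M) * norm (fst d)"
    by (rule norm_diagonal_le) (use w in \<open>smt (verit)\<close>)
  also have "\<dots> \<le> (1 + M) * norm d" using f M by (intro mult_left_mono) auto
  finally have 1: "norm (\<chi> i. (1 + w i) * fst d $ i) \<le> (1 + M) * norm d" .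
  have 2: "norm (snd d *\<^sub>R q) \<le> Q * norm d"
    using mult_mono[OF q s] Q by (simp add: mult.commute)
  have "norm (q \<bullet> fst d) \<le> norm q * norm (fst d)" using Cauchy_Schwarz_ineq2 by auto
  also have "\<dots> \<le> Q * norm d" using mult_mono[OF q f] Q by simp
  finally have 3: "norm (q \<bullet> fst d) \<le> Q * norm d" .
  have "norm (bordered w q d) \<le> norm ((\<chi> i. (1 + w i) * fst d $ i) + snd d *\<^sub>R q) + norm (q \<bullet> fst d)"
    unfolding bordered_def by (rule norm_Pair_le)
  also have "\<dots> \<le> (1 + M) * norm d + Q * norm d + Q * norm d"
    using norm_triangle_ineq[of "\<chi> i. (1 + w i) * fst d $ i" "snd d *\<^sub>R q"] 1 2 3 by linarith
  finally show ?thesis by (simp add: algebra_simps)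
qed

text \<open>Pairing the first block of the system with \<open>d\<^sub>1\<close> eliminates the border, which bounds \<open>d\<^sub>1\<close>
  without inverting the diagonal block.\<close>
lemma norm_le_bordered:
  fixes q :: "real ^ 'm"
  assumes w: "\<And>i. 0 \<le> w i \<and> w i \<le> M" and q: "p \<le> norm q" and p: "0 < p"
  defines "B \<equiv> 1 + 1 / p + (1 + M) / p"
  shows "norm d \<le> (B + (1 + (1 + M) * B) / p) * norm (bordered w q d)"
proof -
  obtain d1 d2 where d: "d = (d1, d2)" by force
  define A where "A = (\<chi> i. (1 + w i) * d1 $ i)"
  define R where "R = norm (bordered w q d)"
  have M: "M \<ge> 0" using w order_trans by blast
  have B: "B \<ge> 1" using p M by (simp add: B_def)
  have R0: "R \<ge> 0" by (simp add: R_def)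
  have r: "bordered w q d = (A + d2 *\<^sub>R q, q \<bullet> d1)" by (simp add: bordered_def d A_def)
  have r1: "norm (A + d2 *\<^sub>R q) \<le> R" and r2: "\<bar>q \<bullet> d1\<bar> \<le> R"
    unfolding R_def r using norm_fst_le[of "A + d2 *\<^sub>R q" "q \<bullet> d1"] norm_snd_le[of "q \<bullet> d1" "A + d2 *\<^sub>R q"]
    by auto
  have A: "norm A \<le> (1 + M) * norm d1"
    unfolding A_def by (rule norm_diagonal_le) (use w in \<open>smt (verit)\<close>)
  \<comment> \<open>The first block determines \<open>d2 *\<^sub>R q\<close> once \<open>A\<close>
    is controlled, and \<open>q\<close> has length at least \<open>p\<close>; so \<open>d2\<close>
    is bounded in terms of \<open>R\<close> and \<open>d1\<close>.\<close>
  have "p * \<bar>d2\<bar> \<le> norm (d2 *\<^sub>R q)" using mult_right_mono[OF q abs_ge_zero[of d2]] by (simp add: mult.commute)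
  also have "\<dots> \<le> norm (A + d2 *\<^sub>R q) + norm A"
    using norm_triangle_ineq4[of "A + d2 *\<^sub>R q" A] by simp
  also have "\<dots> \<le> R + (1 + M) * norm d1" using r1 A by simp
  finally have d2: "\<bar>d2\<bar> \<le> (R + (1 + M) * norm d1) / p" using p by (simp add: field_simps)
  \<comment> \<open>The diagonal entries are at least 1. In the identity that follows, the border
    enters only through \<open>q \<bullet> d1\<close>, which is the second block and hence at most
    \<open>R\<close> in absolute value.\<close>
  have "(norm d1)\<^sup>2 \<le> d1 \<bullet> A"
  proof -
    have "d1 \<bullet> d1 \<le> d1 \<bullet> A"
      unfolding inner_vec_def A_def by (rule sum_mono) (use w in \<open>simp add: algebra_simps\<close>)
    then show ?thesis by (simp add: power2_norm_eq_inner)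
  qed
  also have "\<dots> = d1 \<bullet> (A + d2 *\<^sub>R q) - d2 * (q \<bullet> d1)" by (simp add: inner_add_right inner_commute)
  also have "\<dots> \<le> norm d1 * R + \<bar>d2\<bar> * R"
  proof -
    have "d1 \<bullet> (A + d2 *\<^sub>R q) \<le> norm d1 * R"
      using norm_cauchy_schwarz[of d1 "A + d2 *\<^sub>R q"] mult_left_mono[OF r1 norm_ge_zero[of d1]] by linarith
    moreover have "\<bar>d2 * (q \<bullet> d1)\<bar> \<le> \<bar>d2\<bar> * R" using r2 by (simp add: abs_mult mult_left_mono)
    ultimately show ?thesis by linarith
  qed
  finally have sq: "(norm d1)\<^sup>2 \<le> norm d1 * R + \<bar>d2\<bar> * R" .
  have d1: "norm d1 \<le> B * R"
  proof (cases "norm d1 \<le> R")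
    case True
    then show ?thesis using mult_right_mono[OF B R0] by simp
  next
    \<comment> \<open>Here \<open>R < norm d1\<close>, so the bound on \<open>d2\<close> becomes a
      multiple of \<open>norm d1\<close> alone. Every term of \<open>sq\<close> then carries a
      factor \<open>norm d1\<close>, which can be cancelled; this is where the value of
      \<open>B\<close> comes from.\<close>
    case False
    have "\<bar>d2\<bar> \<le> (1 / p + (1 + M) / p) * norm d1"
    proof -
      have "(R + (1 + M) * norm d1) / p \<le> (norm d1 + (1 + M) * norm d1) / p"
        using False p by (intro divide_right_mono) auto
      then show ?thesis using d2 by (simp add: algebra_simps add_divide_distrib)
    qed
    then have "\<bar>d2\<bar> * R \<le> (1 / p + (1 + M) / p) * norm d1 * R" using R0 by (rule mult_right_mono)
    then have "norm d1 * norm d1 \<le> norm d1 * (B * R)"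
      using sq by (simp add: B_def power2_eq_square algebra_simps)
    moreover have "norm d1 > 0" using False R0 by linarith
    ultimately show ?thesis by simp
  qed
  have "(1 + M) * norm d1 \<le> (1 + M) * (B * R)" using d1 M by (intro mult_left_mono) auto
  then have "(R + (1 + M) * norm d1) / p \<le> (R + (1 + M) * (B * R)) / p"
    using p by (intro divide_right_mono) auto
  then have "\<bar>d2\<bar> \<le> (1 + (1 + M) * B) / p * R" using d2 by (simp add: algebra_simps)
  moreover have "norm d \<le> norm d1 + \<bar>d2\<bar>" using norm_fst_add_snd[of d] by (simp add: d)
  ultimately show ?thesis using d1 unfolding R_def[symmetric] by (simp add: algebra_simps)
qed

section \<open>Newton steps for an abstract family of linear maps\<close>

text \<open>The map \<open>J\<close> sends the error after the step exactly to minus the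
  linearisation error \<open>F y - J (y - z)\<close>, so the inverse bound \<open>c\<close> carries
  the estimate over. The same bound makes \<open>J\<close> injective, hence bijective in finite
  dimension.\<close>

lemma newton_step_contracts:
  fixes F :: "'a::euclidean_space \<Rightarrow> 'a"
  assumes lin: "linear J" and inv: "\<And>d. norm d \<le> c * norm (J d)"
    and approx: "norm (F y - J (y - z)) \<le> e" and c: "c \<ge> 0"
  shows "bij J" and "norm (y + inv J (- F y) - z) \<le> c * e"
proof -
  have "inj J"
  proof (rule injI)
    fix a b assume "J a = J b"
    then have "J (a - b) = 0" using lin by (simp add: linear_diff)
    then show "a = b" using inv[of "a - b"] by simp
  qed
  then show "bij J" using lin linear_injective_imp_surjective unfolding bij_def by blast
  then have "J (inv J (- F y)) = - F y" by (simp add: bij_is_surj surj_f_inv_f)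
  then have "J (y + inv J (- F y) - z) = - (F y - J (y - z))"
    using lin by (simp add: linear_add linear_diff)
  then have "norm (J (y + inv J (- F y) - z)) \<le> e" using approx by (metis norm_minus_cancel)
  then show "norm (y + inv J (- F y) - z) \<le> c * e"
    using inv[of "y + inv J (- F y) - z"] c mult_left_mono order_trans by blast
qed

lemma newton_step_superlinear:
  fixes F :: "'a::euclidean_space \<Rightarrow> 'a" and JJ :: "'a \<Rightarrow> ('a \<Rightarrow> 'a) set"
  assumes reg: "\<forall>\<^sub>F y in nhds z. \<forall>J\<in>JJ y. linear J \<and> (\<forall>d. norm d \<le> c * norm (J d))"
    and approx: "\<And>\<epsilon>. \<epsilon> > 0 \<Longrightarrow> \<forall>\<^sub>F y in nhds z. \<forall>J\<in>JJ y. norm (F y - J (y - z)) \<le> \<epsilon> * norm (y - z)"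
    and c: "c > 0" and \<epsilon>: "\<epsilon> > 0"
  shows "\<forall>\<^sub>F y in nhds z. \<forall>J\<in>JJ y. bij J \<and> norm (y + inv J (- F y) - z) \<le> \<epsilon> * norm (y - z)"
proof -
  have "\<forall>\<^sub>F y in nhds z. \<forall>J\<in>JJ y. norm (F y - J (y - z)) \<le> \<epsilon> / c * norm (y - z)"
    using approx[of "\<epsilon> / c"] c \<epsilon> by simp
  with reg show ?thesis
  proof eventually_elim
    case (elim y)
    show ?case
    proof
      fix J assume J: "J \<in> JJ y"
      then have *: "linear J" "\<And>d. norm d \<le> c * norm (J d)" "norm (F y - J (y - z)) \<le> \<epsilon> / c * norm (y - z)"
        using elim by auto
      show "bij J \<and> norm (y + inv J (- F y) - z) \<le> \<epsilon> * norm (y - z)"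
        using newton_step_contracts[of J c F y z "\<epsilon> / c * norm (y - z)"] * c by simp
    qed
  qed
qed

text \<open>Near \<open>z\<close> the residual and the distance to \<open>z\<close> bound each other
  up to constants, so a step that shrinks the distance by a small enough factor shrinks the residual
  by \<open>\<theta>\<close>.\<close>

lemma newton_step_residual_decrease:
  fixes F :: "'a::euclidean_space \<Rightarrow> 'a" and JJ :: "'a \<Rightarrow> ('a \<Rightarrow> 'a) set"
  assumes reg: "\<forall>\<^sub>F y in nhds z. \<forall>J\<in>JJ y. linear J \<and> (\<forall>d. norm d \<le> c * norm (J d)) \<and> (\<forall>d. norm (J d) \<le> B * norm d)"
    and nonempty: "\<And>y. JJ y \<noteq> {}"
    and approx: "\<And>\<epsilon>. \<epsilon> > 0 \<Longrightarrow> \<forall>\<^sub>F y in nhds z. \<forall>J\<in>JJ y. norm (F y - J (y - z)) \<le> \<epsilon> * norm (y - z)"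
    and c: "c > 0" and \<theta>: "\<theta> > 0"
  shows "\<forall>\<^sub>F y in nhds z. \<forall>J\<in>JJ y. norm (F (y + inv J (- F y))) \<le> \<theta> * norm (F y)"
proof -
  define B' where "B' = \<bar>B\<bar> + 1"
  have B': "B' > 0" by (simp add: B'_def)
  have up: "\<forall>\<^sub>F y in nhds z. norm (F y) \<le> B' * norm (y - z)"
    using reg approx[of 1, simplified]
  proof eventually_elim
    case (elim y)
    obtain J where J: "J \<in> JJ y" using nonempty by blast
    have "norm (F y) \<le> norm (F y - J (y - z)) + norm (J (y - z))" using norm_triangle_sub[of "F y" "J (y - z)"] by simp
    also have "\<dots> \<le> norm (y - z) + B * norm (y - z)" using elim J by (intro add_mono) auto
    also have "\<dots> \<le> B' * norm (y - z)" by (simp add: B'_def algebra_simps mult_right_mono)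
    finally show ?case .
  qed
  \<comment> \<open>With tolerance \<open>1 / (2 * c)\<close> the linearisation error, multiplied by
    \<open>c\<close>, costs half of \<open>norm (y - z)\<close> and is absorbed on the left.\<close>
  have low: "\<forall>\<^sub>F y in nhds z. norm (y - z) \<le> 2 * c * norm (F y)"
    using reg approx[of "1 / (2 * c)", OF divide_pos_pos, OF zero_less_one mult_pos_pos[OF zero_less_numeral c]]
  proof eventually_elim
    case (elim y)
    obtain J where J: "J \<in> JJ y" using nonempty by blast
    have "norm (J (y - z)) \<le> norm (F y) + norm (F y - J (y - z))"
      using norm_triangle_ineq4[of "F y" "F y - J (y - z)"] by simp
    also have "\<dots> \<le> norm (F y) + 1 / (2 * c) * norm (y - z)" using elim J by auto
    finally have "c * norm (J (y - z)) \<le> c * (norm (F y) + 1 / (2 * c) * norm (y - z))"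
      using c by (intro mult_left_mono) auto
    then have "norm (y - z) \<le> c * (norm (F y) + 1 / (2 * c) * norm (y - z))"
      using elim(1) J order_trans by blast
    then show ?case using c by (simp add: field_simps)
  qed
  obtain r where r: "r > 0" and up': "\<And>y. dist y z < r \<Longrightarrow> norm (F y) \<le> B' * norm (y - z)"
    using up unfolding eventually_nhds_metric by blast
  \<comment> \<open>The bound 1 keeps the new point in the ball of radius \<open>r\<close>, where
    \<open>up'\<close> applies to it; the other bound offsets the two comparison constants
    \<open>B'\<close> and \<open>2 * c\<close>.\<close>
  define \<epsilon> where "\<epsilon> = min 1 (\<theta> / (B' * (2 * c)))"
  have \<epsilon>: "\<epsilon> > 0" using \<theta> B' c by (simp add: \<epsilon>_def)
  have "\<forall>\<^sub>F y in nhds z. \<forall>J\<in>JJ y. linear J \<and> (\<forall>d. norm d \<le> c * norm (J d))"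
    using reg by eventually_elim auto
  from newton_step_superlinear[where z = z and JJ = JJ and c = c and F = F, OF this approx c \<epsilon>, simplified] low eventually_nhds_ball[OF r]
  show ?thesis
  proof eventually_elim
    case (elim y)
    show ?case
    proof
      fix J assume J: "J \<in> JJ y"
      let ?y = "y + inv J (- F y)"
      have 1: "norm (?y - z) \<le> \<epsilon> * norm (y - z)" using elim J by auto
      also have "\<dots> \<le> 1 * norm (y - z)" by (intro mult_right_mono) (auto simp: \<epsilon>_def)
      also have "\<dots> < r" using elim by (simp add: dist_norm norm_minus_commute)
      finally have "norm (F ?y) \<le> B' * norm (?y - z)" by (intro up') (simp add: dist_norm)
      also have "\<dots> \<le> B' * (\<epsilon> * (2 * c * norm (F y)))"
        using 1 elim(2) \<epsilon> B' by (meson mult_left_mono less_imp_le order_trans)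
      also have "\<dots> = (B' * (2 * c)) * \<epsilon> * norm (F y)" by simp
      also have "\<dots> \<le> (B' * (2 * c)) * (\<theta> / (B' * (2 * c))) * norm (F y)"
        using B' c by (intro mult_right_mono mult_left_mono) (auto simp: \<epsilon>_def)
      also have "\<dots> = \<theta> * norm (F y)" using B' c by simp
      finally show "norm (F ?y) \<le> \<theta> * norm (F y)" .
    qed
  qed
qed

section \<open>Acceptance of the full step\<close>

text \<open>Exponent 0 means step size \<open>\<beta> ^ 0 = 1\<close>. If the full step passes both
  tests, each \<open>LEAST\<close> is 0, and the relation determines its outcome.\<close>

lemma ssn_step_unit_iff:
  assumes "bij J"
    and "\<not> ereal (Max (range (\<lambda>i. fst (y + inv J (- F y)) $ i))) \<le> a"
    and "norm (F (y + inv J (- F y))) \<le> (1 - \<sigma>) * norm (F y)"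
  shows "ssn_step \<sigma> \<beta> a F J y j y' \<longleftrightarrow> j = 0 \<and> y' = y + inv J (- F y)"
proof -
  let ?d = "inv J (- F y)"
  let ?ok1 = "\<lambda>j::nat. \<not> (ereal (Max (range (\<lambda>i. (fst y + (\<beta> ^ j) *\<^sub>R fst ?d) $ i))) \<le> a)"
  let ?ok2 = "\<lambda>j::nat. norm (F (y + (\<beta> ^ j) *\<^sub>R ?d)) \<le> (1 - \<sigma> * \<beta> ^ j) * norm (F y)"
  have ok1: "?ok1 0" and ok2: "?ok2 0" using assms by auto
  have j1: "(LEAST j. ?ok1 j) = 0" using ok1 by (rule Least_eq_0)
  have j2: "(LEAST j. 0 \<le> j \<and> ?ok2 j) = 0" using ok2 by (intro Least_eq_0) simp
  have ex: "\<exists>j. ?ok1 j" "\<exists>j\<ge>0. ?ok2 j" using ok1 ok2 by blast+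
  show ?thesis unfolding ssn_step_def Let_def j1 j2 using assms(1) ex by auto
qed

section \<open>Differentiable convex functions\<close>

lemma convex_above_tangent:
  fixes l :: "real \<Rightarrow> real"
  assumes "convex_on UNIV l" "\<forall>t. l differentiable (at t)"
  shows "deriv l s * (t - s) \<le> l t - l s"
  using convex_on_imp_above_tangent[of UNIV l s t "deriv l s"] assms
  by (simp add: DERIV_deriv_iff_real_differentiable)

lemma mono_deriv_convex:
  fixes l :: "real \<Rightarrow> real"
  assumes "convex_on UNIV l" "\<forall>t. l differentiable (at t)"
  shows "mono (deriv l)"
proof (rule monoI)
  fix s t :: real assume "s \<le> t"
  have "(deriv l t - deriv l s) * (t - s) \<ge> 0"
    using convex_above_tangent[OF assms, of s t] convex_above_tangent[OF assms, of t s]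
    by (simp add: algebra_simps)
  then show "deriv l s \<le> deriv l t"
    using \<open>s \<le> t\<close> by (cases "s = t") (auto simp: zero_le_mult_iff)
qed

text \<open>The tangent is taken at \<open>t\<close>, the far end, because Newton's method
  linearises at the current iterate. The tangents at \<open>t\<close> and at \<open>s\<close> both
  lie below the graph and squeeze the remainder.\<close>

lemma convex_tangent_remainder:
  fixes l :: "real \<Rightarrow> real"
  assumes "convex_on UNIV l" "\<forall>t. l differentiable (at t)"
  shows "\<bar>l t - l s - deriv l t * (t - s)\<bar> \<le> \<bar>deriv l t - deriv l s\<bar> * \<bar>t - s\<bar>"
proof -
  have "0 \<le> deriv l t * (t - s) - (l t - l s)"
    using convex_above_tangent[OF assms, of t s] by (simp add: algebra_simps)
  moreover have "deriv l t * (t - s) - (l t - l s) \<le> (deriv l t - deriv l s) * (t - s)"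
    using convex_above_tangent[OF assms, of s t] by (simp add: algebra_simps)
  moreover have "(deriv l t - deriv l s) * (t - s) \<le> \<bar>deriv l t - deriv l s\<bar> * \<bar>t - s\<bar>"
    by (metis abs_ge_self abs_mult)
  ultimately show ?thesis by linarith
qed

lemma deriv_nonneg_mono:
  fixes l :: "real \<Rightarrow> real"
  assumes "mono l" "\<forall>t. l differentiable (at t)"
  shows "deriv l t \<ge> 0"
  using mono_on_imp_deriv_nonneg[of UNIV l "deriv l t" t] assms
  by (simp add: mono_on_def monoD DERIV_deriv_iff_real_differentiable)

section \<open>From scalar conditions to neighbourhoods of a point\<close>

lemma semismooth_wrt_isCont:
  assumes "semismooth_wrt g K t"
  shows "isCont g t"
proof -
  obtain U C where "open U" "t \<in> U" "C-lipschitz_on U g"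
    using assms unfolding semismooth_wrt_def by blast
  then show ?thesis using lipschitz_on_continuous_on continuous_on_eq_continuous_at by blast
qed

lemma semismooth_wrt_clarke_mapsD:
  assumes "semismooth_wrt g (clarke_maps g) t" "\<epsilon> > 0"
  shows "\<forall>\<^sub>F s in nhds t. \<forall>\<eta>\<in>clarke_subdiff g s. \<bar>g s - g t - \<eta> * (s - t)\<bar> \<le> \<epsilon> * \<bar>s - t\<bar>"
proof -
  obtain \<delta> where \<delta>: "\<delta> > 0" and *: "\<And>h V. norm h < \<delta> \<Longrightarrow> V \<in> clarke_maps g (t + h) \<Longrightarrow>
      norm (g (t + h) - g t - V h) \<le> \<epsilon> * norm h"
    using assms unfolding semismooth_wrt_def by blast
  show ?thesis
    unfolding eventually_nhds_metric
  proof (intro exI[of _ \<delta>] conjI \<delta> allI impI ballI)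
    fix s \<eta> assume "dist s t < \<delta>" "\<eta> \<in> clarke_subdiff g s"
    then show "\<bar>g s - g t - \<eta> * (s - t)\<bar> \<le> \<epsilon> * \<bar>s - t\<bar>"
      using *[of "s - t" "\<lambda>h. \<eta> * h"] by (simp add: clarke_maps_def dist_real_def)
  qed
qed

lemma eventually_nhds_components:
  fixes u :: "real ^ 'm"
  assumes "\<And>i. \<forall>\<^sub>F s in nhds (u $ i). P i s"
  shows "\<forall>\<^sub>F y in nhds (u, \<rho>::real). \<forall>i. P i (fst y $ i)"
proof -
  have "\<forall>\<^sub>F y in nhds (u, \<rho>). P i (fst y $ i)" for i
  proof -
    have "((\<lambda>y. fst y $ i) \<longlongrightarrow> fst (u, \<rho>) $ i) (nhds (u, \<rho>))"
      by (intro tendsto_vec_nth tendsto_fst filterlim_ident)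
    then show ?thesis using assms[of i] by (simp add: filterlim_iff)
  qed
  then show ?thesis by (rule eventually_all_finite)
qed

lemma tendsto_gradL:
  fixes u :: "real ^ 'm"
  assumes "\<And>t. isCont (deriv l) t"
  shows "((\<lambda>y. gradL l (fst y)) \<longlongrightarrow> gradL l u) (nhds (u, \<rho>::real))"
  unfolding gradL_def
proof (intro tendsto_vec_lambda)
  fix i
  have "((\<lambda>y. fst y $ i) \<longlongrightarrow> fst (u, \<rho>) $ i) (nhds (u, \<rho>))"
    by (intro tendsto_vec_nth tendsto_fst filterlim_ident)
  then show "((\<lambda>y. deriv l (fst y $ i)) \<longlongrightarrow> deriv l (u $ i)) (nhds (u, \<rho>))"
    using isCont_tendsto_compose[OF assms] by fastforce
qed

section \<open>The family \<open>JF\<close> near the solution and the threshold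
  \<open>a_thr\<close>\<close>

text \<open>Moves the factor \<open>1/m\<close> into the border and \<open>\<rho>/m\<close> into the
  diagonal weights, so that the bounds for bordered maps apply.\<close>

lemma JF_eq_bordered:
  fixes y :: "(real ^ 'm) \<times> real"
  shows "JF l y = {bordered (\<lambda>i. snd y / real CARD('m) * \<eta> i) (gradL l (fst y) /\<^sub>R real CARD('m))
             | \<eta>. \<forall>i. \<eta> i \<in> clarke_subdiff (deriv l) (fst y $ i)}"
proof -
  have "(\<lambda>d. (fst d + (snd y / real CARD('m)) *\<^sub>R (\<chi> i. \<eta> i * fst d $ i)
                       + (snd d / real CARD('m)) *\<^sub>R gradL l (fst y),
                    (gradL l (fst y) \<bullet> fst d) / real CARD('m)))
     = bordered (\<lambda>i. snd y / real CARD('m) * \<eta> i) (gradL l (fst y) /\<^sub>R real CARD('m))" for \<eta> :: "'m \<Rightarrow> real"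
    by (rule ext) (simp add: bordered_def vec_eq_iff field_simps)
  then show ?thesis unfolding JF_def by simp
qed

text \<open>Reduces the first line search to the condition of a nonzero gradient. A component with
  positive derivative is an upper bound of the zero set of \<open>deriv l\<close>. By continuity
  that set contains its supremum, so the component lies strictly above it.\<close>

lemma max_gt_a_thr:
  fixes u :: "real ^ 'm"
  assumes mono: "mono (deriv l)" and nonneg: "\<And>t. deriv l t \<ge> 0" and cont: "\<And>t. isCont (deriv l) t"
    and u: "gradL l u \<noteq> 0"
  shows "\<not> ereal (Max (range (\<lambda>i. u $ i))) \<le> a_thr l"
proof (cases "\<forall>t. deriv l t > 0")
  case True
  then show ?thesis by (simp add: a_thr_def)
next
  case False
  define Z where "Z = {t. deriv l t = 0}"
  obtain i where "deriv l (u $ i) \<noteq> 0" using u by (auto simp: gradL_def vec_eq_iff)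
  then have i: "deriv l (u $ i) > 0" using nonneg[of "u $ i"] by simp
  have ub: "t \<le> u $ i" if "t \<in> Z" for t
    using monoD[OF mono, of "u $ i" t] i that by (force simp: Z_def)
  have "Z \<noteq> {}" using False nonneg by (auto simp: Z_def not_less intro: antisym)
  moreover have "closed Z"
    unfolding Z_def by (intro closed_Collect_eq continuous_at_imp_continuous_on) (auto simp: cont)
  moreover have "bdd_above Z" using ub by (auto simp: bdd_above_def)
  ultimately have "Sup Z \<in> Z" by (intro closed_contains_Sup)
  then have "Sup Z \<le> u $ i" "Sup Z \<noteq> u $ i" using ub i by (auto simp: Z_def)
  then have "Sup Z < u $ i" by simp
  also have "u $ i \<le> Max (range (\<lambda>i. u $ i))" by (intro Max_ge) auto
  finally show ?thesis unfolding a_thr_def if_not_P[OF False] Z_def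
    by (simp only: ereal_less_eq not_le)
qed

lemma eventually_clarke_subdiff_bounded:
  fixes u :: "real ^ 'm"
  assumes mono: "mono g" and semi: "\<forall>t. semismooth_wrt g K t"
  shows "\<exists>C\<ge>0. \<forall>\<^sub>F y in nhds (u, \<rho>::real). \<forall>i. clarke_subdiff g (fst y $ i) \<subseteq> {0..C}"
proof -
  have "\<forall>t. \<exists>U C. open U \<and> t \<in> U \<and> C-lipschitz_on U g"
    using semi unfolding semismooth_wrt_def by auto
  then obtain U C where U: "\<And>t. open (U t)" "\<And>t. t \<in> U t" "\<And>t. (C t)-lipschitz_on (U t) g" by metis
  \<comment> \<open>The sum of the nonnegative local Lipschitz constants serves as a common bound
    for all coordinates.\<close>
  define M where "M = (\<Sum>i\<in>UNIV. C (u $ i))"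
  have C0: "C t \<ge> 0" for t using U(3) lipschitz_on_nonneg by blast
  have "\<forall>\<^sub>F s in nhds (u $ i). clarke_subdiff g s \<subseteq> {0..M}" for i
  proof -
    have "C (u $ i) \<le> M" unfolding M_def by (rule member_le_sum) (use C0 in auto)
    then have "clarke_subdiff g s \<subseteq> {0..M}" if "s \<in> U (u $ i)" for s
      using clarke_subdiff_mono_lipschitz[OF mono U(3) U(1) that] by auto
    then show ?thesis unfolding eventually_nhds using U(1,2) by blast
  qed
  then have "\<forall>\<^sub>F y in nhds (u, \<rho>). \<forall>i. clarke_subdiff g (fst y $ i) \<subseteq> {0..M}"
    by (rule eventually_nhds_components)
  moreover have "M \<ge> 0" unfolding M_def using C0 by (intro sum_nonneg) auto
  ultimately show ?thesis by blast
qed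

lemma JF_nonempty:
  fixes y :: "(real ^ 'm) \<times> real"
  assumes mono: "mono (deriv l)" and semi: "\<forall>t. semismooth_wrt (deriv l) K t"
  shows "JF l y \<noteq> {}"
proof -
  have "countable {t. \<not> deriv l differentiable (at t)}"
    using semi unfolding semismooth_wrt_def by (intro countable_not_differentiable_if_one_sided) auto
  moreover have "\<exists>U C. open U \<and> t \<in> U \<and> C-lipschitz_on U (deriv l)" for t
    using semi unfolding semismooth_wrt_def by auto
  ultimately have "clarke_subdiff (deriv l) t \<noteq> {}" for t
    using clarke_subdiff_nonempty[OF mono] by metis
  then have "\<forall>i. \<exists>\<eta>. \<eta> \<in> clarke_subdiff (deriv l) (fst y $ i)" by auto
  then obtain \<eta> where "\<forall>i. \<eta> i \<in> clarke_subdiff (deriv l) (fst y $ i)" by metis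
  then show ?thesis unfolding JF_def by blast
qed

lemma eventually_JF_regular:
  fixes ystar :: "(real ^ 'm) \<times> real"
  assumes mono: "mono (deriv l)" and semi: "\<forall>t. semismooth_wrt (deriv l) K t"
    and pos: "snd ystar > 0" and grad: "gradL l (fst ystar) \<noteq> 0"
  shows "\<exists>c B. c > 0 \<and> (\<forall>\<^sub>F y in nhds ystar. \<forall>J\<in>JF l y.
    linear J \<and> (\<forall>d. norm d \<le> c * norm (J d)) \<and> (\<forall>d. norm (J d) \<le> B * norm d))"
proof -
  obtain u \<rho> where ys: "ystar = (u, \<rho>)" by force
  obtain C where C: "C \<ge> 0"
    "\<forall>\<^sub>F y in nhds (u, \<rho>). \<forall>i. clarke_subdiff (deriv l) (fst y $ i) \<subseteq> {0..C}"
    using eventually_clarke_subdiff_bounded[OF mono semi] by blast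
  define q where "q y = gradL l (fst y) /\<^sub>R real CARD('m)" for y :: "(real ^ 'm) \<times> real"
  have cont: "isCont (deriv l) t" for t using semi semismooth_wrt_isCont by blast
  have "((\<lambda>y. norm (q y)) \<longlongrightarrow> norm (q ystar)) (nhds ystar)"
    unfolding q_def ys fst_conv by (intro tendsto_intros tendsto_gradL cont)
  \<comment> \<open>The norm of the border tends to \<open>2 * p\<close>, hence lies between
    \<open>p\<close> and \<open>3 * p\<close> nearby. Likewise the multiplier stays between 0 and
    \<open>2 * \<rho>\<close>, which yields the bound \<open>M\<close> on the weights.\<close>
  moreover define p where "p = norm (q ystar) / 2"
  moreover have p: "p > 0" using grad by (simp add: p_def q_def)
  ultimately have qlow: "\<forall>\<^sub>F y in nhds ystar. p < norm (q y)"
    and qup: "\<forall>\<^sub>F y in nhds ystar. norm (q y) < 3 * p"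
    by (auto intro!: order_tendstoD)
  have "((\<lambda>y. snd y) \<longlongrightarrow> snd ystar) (nhds ystar)" by (intro tendsto_snd filterlim_ident)
  then have slow: "\<forall>\<^sub>F y in nhds ystar. 0 < snd y" and sup: "\<forall>\<^sub>F y in nhds ystar. snd y < 2 * \<rho>"
    using pos ys by (auto intro!: order_tendstoD)
  define M where "M = 2 * \<rho> / real CARD('m) * C"
  have M: "M \<ge> 0" using C pos ys by (simp add: M_def)
  define b where "b = 1 + 1 / p + (1 + M) / p"
  define c where "c = b + (1 + (1 + M) * b) / p"
  have b: "b > 0" using p M by (simp add: b_def add_pos_nonneg)
  then have c: "c > 0" using p M by (simp add: c_def add_pos_nonneg)
  have "\<forall>\<^sub>F y in nhds ystar. \<forall>J\<in>JF l y.
    linear J \<and> (\<forall>d. norm d \<le> c * norm (J d)) \<and> (\<forall>d. norm (J d) \<le> (1 + M + 2 * (3 * p)) * norm d)"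
    using C(2)[folded ys] qlow qup slow sup
  proof eventually_elim
    case (elim y)
    show ?case
    proof
      fix J assume "J \<in> JF l y"
      then obtain \<eta> where \<eta>: "\<And>i. \<eta> i \<in> clarke_subdiff (deriv l) (fst y $ i)"
        and J: "J = bordered (\<lambda>i. snd y / real CARD('m) * \<eta> i) (q y)"
        unfolding JF_eq_bordered q_def by blast
      have w: "0 \<le> snd y / real CARD('m) * \<eta> i \<and> snd y / real CARD('m) * \<eta> i \<le> M" for i
      proof -
        have "\<eta> i \<in> {0..C}" using \<eta> elim(1) by blast
        then have \<eta>i: "0 \<le> \<eta> i" "\<eta> i \<le> C" by auto
        moreover have "snd y / real CARD('m) \<le> 2 * \<rho> / real CARD('m)"
          using elim by (intro divide_right_mono) auto
        moreover have "0 \<le> snd y / real CARD('m)" using elim by simp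
        ultimately show ?thesis unfolding M_def by (intro conjI mult_mono mult_nonneg_nonneg) linarith+
      qed
      show "linear J \<and> (\<forall>d. norm d \<le> c * norm (J d)) \<and> (\<forall>d. norm (J d) \<le> (1 + M + 2 * (3 * p)) * norm d)"
        unfolding J c_def b_def using elim
        by (intro conjI allI linear_bordered norm_le_bordered bordered_norm_le w p) auto
    qed
  qed
  then show ?thesis using c by blast
qed

section \<open>Linearisation error of \<open>Fmap\<close>\<close>

text \<open>Each of the m coordinates contributes at most \<open>e * norm (u - v)\<close>, and the
  division by m cancels their number.\<close>

lemma Lsum_tangent_remainder:
  fixes u v :: "real ^ 'm"
  assumes conv: "convex_on UNIV l" and diff: "\<forall>t. l differentiable (at t)"
    and close: "\<And>i. \<bar>deriv l (u $ i) - deriv l (v $ i)\<bar> \<le> e"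
  shows "\<bar>(Lsum l u - Lsum l v - gradL l u \<bullet> (u - v)) / real CARD('m)\<bar> \<le> e * norm (u - v)"
proof -
  have "\<bar>Lsum l u - Lsum l v - gradL l u \<bullet> (u - v)\<bar>
      = \<bar>\<Sum>i\<in>UNIV. l (u $ i) - l (v $ i) - deriv l (u $ i) * (u $ i - v $ i)\<bar>"
    by (simp add: Lsum_def gradL_def inner_vec_def sum_subtractf)
  also have "\<dots> \<le> (\<Sum>i\<in>(UNIV::'m set). e * norm (u - v))"
  proof (rule order_trans[OF sum_abs], rule sum_mono)
    fix i
    have "\<bar>l (u $ i) - l (v $ i) - deriv l (u $ i) * (u $ i - v $ i)\<bar>
        \<le> \<bar>deriv l (u $ i) - deriv l (v $ i)\<bar> * \<bar>u $ i - v $ i\<bar>"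
      by (rule convex_tangent_remainder[OF conv diff])
    also have "\<dots> \<le> e * norm (u - v)"
      using close[of i] component_le_norm_cart[of "u - v" i] abs_ge_zero order_trans
      by (intro mult_mono) auto
    finally show "\<bar>l (u $ i) - l (v $ i) - deriv l (u $ i) * (u $ i - v $ i)\<bar> \<le> e * norm (u - v)" .
  qed
  also have "\<dots> = real CARD('m) * (e * norm (u - v))" by simp
  finally show ?thesis by (simp add: abs_divide divide_le_eq mult.commute)
qed

text \<open>The first block leaves \<open>\<rho>\<close> times the semismooth remainder of
  \<open>deriv l\<close> and a product of two small differences with a bounded
  \<open>\<eta> i\<close>. The second block is the tangent remainder of \<open>Lsum\<close>. Each
  block receives half of \<open>\<epsilon>\<close>.\<close>

lemma Fmap_semismooth_estimate:
  fixes ystar :: "(real ^ 'm) \<times> real"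
  assumes conv: "convex_on UNIV l" and diff: "\<forall>t. l differentiable (at t)"
    and semi: "\<forall>t. semismooth_wrt (deriv l) (clarke_maps (deriv l)) t"
    and \<epsilon>: "\<epsilon> > 0"
  shows "\<forall>\<^sub>F y in nhds ystar. \<forall>J\<in>JF l y.
    norm (Fmap l lam x y - Fmap l lam x ystar - J (y - ystar)) \<le> \<epsilon> * norm (y - ystar)"
proof -
  obtain u \<rho> where ys: "ystar = (u, \<rho>)" by force
  have mono: "mono (deriv l)" using mono_deriv_convex[OF conv diff] .
  obtain C where C: "C \<ge> 0"
    "\<forall>\<^sub>F y in nhds (u, \<rho>). \<forall>i. clarke_subdiff (deriv l) (fst y $ i) \<subseteq> {0..C}"
    using eventually_clarke_subdiff_bounded[OF mono semi] by blast
  \<comment> \<open>Chosen so that \<open>\<bar>\<rho>\<bar> * e\<close> is at most a quarter of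
    \<open>\<epsilon>\<close>; adding 1 covers \<open>\<rho> = 0\<close>.\<close>
  define e where "e = \<epsilon> / 4 / (\<bar>\<rho>\<bar> + 1)"
  have e: "e > 0" using \<epsilon> by (simp add: e_def)
  have \<rho>e: "\<bar>\<rho>\<bar> * e \<le> \<epsilon> / 4" using \<epsilon> by (simp add: e_def field_simps)
  have ev1: "\<forall>\<^sub>F y in nhds (u, \<rho>). \<forall>i. \<forall>\<eta>\<in>clarke_subdiff (deriv l) (fst y $ i).
      \<bar>deriv l (fst y $ i) - deriv l (u $ i) - \<eta> * (fst y $ i - u $ i)\<bar> \<le> e * \<bar>fst y $ i - u $ i\<bar>"
    using semismooth_wrt_clarke_mapsD[OF _ e] semi by (intro eventually_nhds_components) blast
  have ev2: "\<forall>\<^sub>F y in nhds (u, \<rho>). \<forall>i. \<bar>deriv l (fst y $ i) - deriv l (u $ i)\<bar> \<le> \<epsilon> / 2"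
  proof (rule eventually_nhds_components)
    fix i
    have "(deriv l \<longlongrightarrow> deriv l (u $ i)) (nhds (u $ i))"
      using semi semismooth_wrt_isCont by (metis continuous_at_imp_continuous_at_within continuous_at tendsto_at_iff_tendsto_nhds)
    then have "\<forall>\<^sub>F s in nhds (u $ i). dist (deriv l s) (deriv l (u $ i)) < \<epsilon> / 2"
      using \<epsilon> by (intro tendstoD) auto
    then show "\<forall>\<^sub>F s in nhds (u $ i). \<bar>deriv l s - deriv l (u $ i)\<bar> \<le> \<epsilon> / 2"
      by eventually_elim (simp add: dist_real_def)
  qed
  have ev3: "\<forall>\<^sub>F y in nhds (u, \<rho>). \<bar>snd y - \<rho>\<bar> * C \<le> \<epsilon> / 4"
  proof -
    have "((\<lambda>y. \<bar>snd y - \<rho>\<bar> * C) \<longlongrightarrow> \<bar>snd (u, \<rho>) - \<rho>\<bar> * C) (nhds (u, \<rho>))"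
      by (intro tendsto_intros tendsto_snd filterlim_ident)
    then have "\<forall>\<^sub>F y in nhds (u, \<rho>). \<bar>snd y - \<rho>\<bar> * C < \<epsilon> / 4"
      using \<epsilon> by (intro order_tendstoD(2)) auto
    then show ?thesis by eventually_elim simp
  qed
  show ?thesis unfolding ys using C(2) ev1 ev2 ev3
  proof eventually_elim
    case (elim y)
    obtain v r where y: "y = (v, r)" by force
    show ?case
    proof
      fix J assume "J \<in> JF l y"
      then obtain \<eta> where \<eta>: "\<And>i. \<eta> i \<in> clarke_subdiff (deriv l) (fst y $ i)"
        and J: "J = (\<lambda>d. (fst d + (snd y / real CARD('m)) *\<^sub>R (\<chi> i. \<eta> i * fst d $ i)
                       + (snd d / real CARD('m)) *\<^sub>R gradL l (fst y),
                    (gradL l (fst y) \<bullet> fst d) / real CARD('m)))"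
        unfolding JF_def by blast
      let ?E = "Fmap l lam x y - Fmap l lam x (u, \<rho>) - J (y - (u, \<rho>))"
      have m: "real CARD('m) \<ge> 1" using zero_less_card_finite[where 'a='m] by linarith
      \<comment> \<open>The identity part cancels, and so do the terms in
        \<open>r * deriv l (v $ i)\<close>; writing the remaining \<open>r * \<eta> i\<close> as
        \<open>\<rho> * \<eta> i + (r - \<rho>) * \<eta> i\<close> isolates the semismooth
        remainder.\<close>
      have fst: "fst ?E $ i = (\<rho> * (deriv l (v $ i) - deriv l (u $ i) - \<eta> i * (v $ i - u $ i))
          - (r - \<rho>) * \<eta> i * (v $ i - u $ i)) / real CARD('m)" for i
        using m by (simp add: Fmap_def J y gradL_def field_simps)
      have snd: "snd ?E = (Lsum l v - Lsum l u - gradL l v \<bullet> (v - u)) / real CARD('m)"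
        by (simp add: Fmap_def J y diff_divide_distrib)
      have "norm (fst ?E) \<le> norm ((\<epsilon> / 2) *\<^sub>R (v - u))"
      proof (rule norm_le_componentwise_cart)
        fix i
        have \<eta>i: "\<eta> i \<in> {0..C}" using \<eta> elim(1) by blast
        have "\<bar>\<rho> * (deriv l (v $ i) - deriv l (u $ i) - \<eta> i * (v $ i - u $ i))\<bar> \<le> \<bar>\<rho>\<bar> * (e * \<bar>v $ i - u $ i\<bar>)"
          using elim(2) \<eta>[of i] by (auto simp: abs_mult y intro!: mult_left_mono)
        also have "\<dots> \<le> \<epsilon> / 4 * \<bar>v $ i - u $ i\<bar>"
          using mult_right_mono[OF \<rho>e, of "\<bar>v $ i - u $ i\<bar>"] by (simp add: mult.assoc)
        finally have 1: "\<bar>\<rho> * (deriv l (v $ i) - deriv l (u $ i) - \<eta> i * (v $ i - u $ i))\<bar> \<le> \<epsilon> / 4 * \<bar>v $ i - u $ i\<bar>" .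
        have "\<bar>r - \<rho>\<bar> * \<eta> i \<le> \<bar>r - \<rho>\<bar> * C" using \<eta>i by (intro mult_left_mono) auto
        also have "\<dots> \<le> \<epsilon> / 4" using elim(4) by (simp add: y)
        finally have "\<bar>(r - \<rho>) * \<eta> i\<bar> \<le> \<epsilon> / 4" using \<eta>i by (simp add: abs_mult)
        then have 2: "\<bar>(r - \<rho>) * \<eta> i * (v $ i - u $ i)\<bar> \<le> \<epsilon> / 4 * \<bar>v $ i - u $ i\<bar>"
          unfolding abs_mult[of _ "v $ i - u $ i"] by (rule mult_right_mono) simp
        define X where "X = \<rho> * (deriv l (v $ i) - deriv l (u $ i) - \<eta> i * (v $ i - u $ i))
            - (r - \<rho>) * \<eta> i * (v $ i - u $ i)"
        have "norm (fst ?E $ i) = \<bar>X\<bar> / real CARD('m)"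
          unfolding fst X_def[symmetric] by (simp add: abs_divide)
        also have "\<dots> \<le> \<bar>X\<bar> / 1" using m by (intro divide_left_mono) auto
        also have "\<dots> \<le> \<epsilon> / 4 * \<bar>v $ i - u $ i\<bar> + \<epsilon> / 4 * \<bar>v $ i - u $ i\<bar>"
          unfolding X_def div_by_1 by (rule order_trans[OF abs_triangle_ineq4 add_mono[OF 1 2]])
        also have "\<dots> = \<epsilon> / 2 * \<bar>v $ i - u $ i\<bar>" by simp
        also have "\<dots> = norm (((\<epsilon> / 2) *\<^sub>R (v - u)) $ i)" using \<epsilon> by (simp add: abs_mult)
        finally show "norm (fst ?E $ i) \<le> norm (((\<epsilon> / 2) *\<^sub>R (v - u)) $ i)" .
      qed
      also have "\<dots> = \<epsilon> / 2 * norm (v - u)" using \<epsilon> by simp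
      finally have 1: "norm (fst ?E) \<le> \<epsilon> / 2 * norm (v - u)" .
      have 2: "norm (snd ?E) \<le> \<epsilon> / 2 * norm (v - u)"
        unfolding snd real_norm_def by (rule Lsum_tangent_remainder[OF conv diff]) (use elim(3) in \<open>simp add: y\<close>)
      have "norm ?E \<le> norm (fst ?E) + norm (snd ?E)" by (rule norm_fst_add_snd)
      also have "\<dots> \<le> \<epsilon> * norm (v - u)" using 1 2 by linarith
      also have "\<dots> \<le> \<epsilon> * norm (y - (u, \<rho>))"
        using \<epsilon> norm_fst_le[of "v - u" "r - \<rho>"] by (intro mult_left_mono) (auto simp: y)
      finally show "norm ?E \<le> \<epsilon> * norm (y - (u, \<rho>))" .
    qed
  qed
qed

section \<open>Local convergence of the iteration\<close>

theorem mainTheorem6: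
  fixes l :: "real \<Rightarrow> real" and lam \<sigma> \<beta> :: real
    and x :: "real ^ 'm" and ystar :: "(real ^ 'm) \<times> real"
  assumes A1_mono: "mono l"
    and A1_convex: "convex_on UNIV l"
    and A1_inf: "\<exists>t. l t < lam"
    and A3_diff: "\<forall>t. l differentiable (at t)"
    and A3_nonconst: "\<exists>s t. l s \<noteq> l t"
    and A3_semismooth: "\<forall>t. semismooth_wrt (deriv l) (clarke_maps (deriv l)) t"
    and x_notin: "x \<notin> Zset l lam"
    and sol: "Fmap l lam x ystar = 0" and rho_pos: "snd ystar > 0"
    and uniq: "\<forall>y. Fmap l lam x y = 0 \<and> snd y > 0 \<longrightarrow> y = ystar"
    and sigma: "0 < \<sigma>" "\<sigma> < 1" and beta: "0 < \<beta>" "\<beta> < 1"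
  shows "\<exists>\<delta>>0. \<forall>y0. y0 \<in> ball ystar \<delta> \<and> gradL l (fst y0) \<noteq> 0 \<longrightarrow>
     (\<comment> \<open>well-definedness and unit step: at every reachable iterate, for every choice of J\<close>
      (\<forall>y J n. y 0 = y0 \<and> ssn_seq \<sigma> \<beta> l lam x y J n \<longrightarrow>
          JF l (y n) \<noteq> {} \<and>
          (\<forall>J'\<in>JF l (y n). \<exists>y'. ssn_step \<sigma> \<beta> (a_thr l) (Fmap l lam x) J' (y n) 0 y'))) \<and>
     (\<comment> \<open>Q-superlinear convergence\<close>
      (\<forall>y J. y 0 = y0 \<and> (\<forall>n. ssn_seq \<sigma> \<beta> l lam x y J n) \<longrightarrow>
          y \<longlonglongrightarrow> ystar \<and>
          (\<forall>\<epsilon>>0. \<exists>K. \<forall>k\<ge>K. norm (y (Suc k) - ystar) \<le> \<epsilon> * norm (y k - ystar)))) \<and>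
     (\<comment> \<open>quadratic convergence under strong semismoothness of F\<close>
      (\<forall>z. strongly_semismooth_wrt (Fmap l lam x) (JF l) z) \<longrightarrow>
      (\<forall>y J. y 0 = y0 \<and> (\<forall>n. ssn_seq \<sigma> \<beta> l lam x y J n) \<longrightarrow>
          (\<exists>C K. \<forall>k\<ge>K. norm (y (Suc k) - ystar) \<le> C * (norm (y k - ystar))\<^sup>2)))"
proof -
  define F where "F = Fmap l lam x"
  have gmono: "mono (deriv l)" using mono_deriv_convex[OF A1_convex A3_diff] .
  have gnonneg: "deriv l t \<ge> 0" for t using deriv_nonneg_mono[OF A1_mono A3_diff] .
  have gcont: "isCont (deriv l) t" for t using A3_semismooth semismooth_wrt_isCont by blast
  have nonempty: "JF l y \<noteq> {}" for y :: "(real ^ 'm) \<times> real" using JF_nonempty[OF gmono A3_semismooth] .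
  have F0: "F ystar = 0" using sol by (simp add: F_def)
  have grad: "gradL l (fst ystar) \<noteq> 0"
  proof
    assume "gradL l (fst ystar) = 0"
    then have "fst ystar = x" "Lsum l (fst ystar) / real CARD('m) = lam"
      using sol by (auto simp: Fmap_def prod_eq_iff)
    then show False using x_notin by (simp add: Zset_def Lsum_def)
  qed
  obtain c B where c: "c > 0" and reg: "\<forall>\<^sub>F y in nhds ystar. \<forall>J\<in>JF l y.
      linear J \<and> (\<forall>d. norm d \<le> c * norm (J d)) \<and> (\<forall>d. norm (J d) \<le> B * norm d)"
    using eventually_JF_regular[OF gmono A3_semismooth rho_pos grad] by blast
  have reg': "\<forall>\<^sub>F y in nhds ystar. \<forall>J\<in>JF l y. linear J \<and> (\<forall>d. norm d \<le> c * norm (J d))"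
    using reg by eventually_elim auto
  have approx: "\<forall>\<^sub>F y in nhds ystar. \<forall>J\<in>JF l y. norm (F y - J (y - ystar)) \<le> \<epsilon> * norm (y - ystar)"
    if "\<epsilon> > 0" for \<epsilon>
    using Fmap_semismooth_estimate[OF A1_convex A3_diff A3_semismooth that, where lam = lam and x = x and ystar = ystar]
    by (simp add: F0[unfolded F_def] F_def)
  have superlin: "\<forall>\<^sub>F y in nhds ystar. \<forall>J\<in>JF l y. bij J \<and>
      norm (y + inv J (- F y) - ystar) \<le> \<epsilon> * norm (y - ystar)" if "\<epsilon> > 0" for \<epsilon>
    by (rule newton_step_superlinear[OF reg' approx c that])
  have decrease: "\<forall>\<^sub>F y in nhds ystar. \<forall>J\<in>JF l y. norm (F (y + inv J (- F y))) \<le> (1 - \<sigma>) * norm (F y)"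
    by (rule newton_step_residual_decrease[OF reg nonempty approx c]) (use sigma in auto)
  have "\<forall>\<^sub>F y in nhds ystar. gradL l (fst y) \<noteq> 0"
    using tendsto_imp_eventually_ne[OF tendsto_gradL[OF gcont, of "fst ystar" "snd ystar"] grad] by simp
  \<comment> \<open>A fixed contraction factor suffices to choose \<open>\<delta>\<close>: it
    confines the iterates to the ball and makes them converge. The rates come afterwards, from
    smaller neighbourhoods.\<close>
  with superlin[of "1 / 2"] decrease
  have "\<forall>\<^sub>F y in nhds ystar. gradL l (fst y) \<noteq> 0 \<and> (\<forall>J\<in>JF l y. bij J \<and>
      norm (y + inv J (- F y) - ystar) \<le> 1 / 2 * norm (y - ystar) \<and>
      norm (F (y + inv J (- F y))) \<le> (1 - \<sigma>) * norm (F y))"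
    by (auto elim: eventually_elim2 intro: eventually_conj simp: eventually_conj_iff ball_conj_distrib)
  then obtain \<delta> where \<delta>: "\<delta> > 0" and near: "\<And>y. dist y ystar < \<delta> \<Longrightarrow> gradL l (fst y) \<noteq> 0 \<and> (\<forall>J\<in>JF l y. bij J \<and>
      norm (y + inv J (- F y) - ystar) \<le> 1 / 2 * norm (y - ystar) \<and>
      norm (F (y + inv J (- F y))) \<le> (1 - \<sigma>) * norm (F y))"
    unfolding eventually_nhds_metric by blast
  \<comment> \<open>The first test concerns the new point. By contraction that point is still in the
    ball, where the gradient does not vanish, so \<open>max_gt_a_thr\<close> applies to it.\<close>
  have step: "ssn_step \<sigma> \<beta> (a_thr l) F J y j y' \<longleftrightarrow> j = 0 \<and> y' = y + inv J (- F y)"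
    and contr: "norm (y + inv J (- F y) - ystar) \<le> 1 / 2 * norm (y - ystar)"
    if y: "dist y ystar < \<delta>" and J: "J \<in> JF l y" for J y j y'
  proof -
    show half: "norm (y + inv J (- F y) - ystar) \<le> 1 / 2 * norm (y - ystar)"
      using near[OF y] J by blast
    also have "\<dots> \<le> norm (y - ystar)" by simp
    finally have "dist (y + inv J (- F y)) ystar < \<delta>" using y by (simp add: dist_norm)
    then have "gradL l (fst (y + inv J (- F y))) \<noteq> 0" using near by blast
    then have "\<not> ereal (Max (range (\<lambda>i. fst (y + inv J (- F y)) $ i))) \<le> a_thr l"
      by (rule max_gt_a_thr[OF gmono gnonneg gcont])
    then show "ssn_step \<sigma> \<beta> (a_thr l) F J y j y' \<longleftrightarrow> j = 0 \<and> y' = y + inv J (- F y)"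
      using near[OF y] J by (intro ssn_step_unit_iff) auto
  qed
  \<comment> \<open>\<open>ssn_seq\<close> with bound \<open>n\<close> constrains the steps below
    \<open>n\<close>, hence the iterates up to and including \<open>y n\<close>. Finite runs are
    covered because well-definedness is claimed after any of them.\<close>
  have iterate: "norm (y k - ystar) \<le> (1 / 2) ^ k * norm (y 0 - ystar)"
    if y0: "y 0 \<in> ball ystar \<delta>" and seq: "ssn_seq \<sigma> \<beta> l lam x y J n" and k: "k \<le> n" for y J n k
    using k
  proof (induction k)
    case 0
    then show ?case by simp
  next
    case (Suc k)
    have IH: "norm (y k - ystar) \<le> (1 / 2) ^ k * norm (y 0 - ystar)" using Suc by simp
    also have "\<dots> \<le> 1 * norm (y 0 - ystar)" by (intro mult_right_mono) (auto simp: power_le_one)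
    finally have near_k: "dist (y k) ystar < \<delta>" using y0 by (simp add: dist_norm norm_minus_commute)
    obtain j where "J k \<in> JF l (y k)" "ssn_step \<sigma> \<beta> (a_thr l) F (J k) (y k) j (y (Suc k))"
      using seq Suc.prems unfolding ssn_seq_def F_def by (meson Suc_le_lessD)
    then have "norm (y (Suc k) - ystar) \<le> 1 / 2 * norm (y k - ystar)"
      using step[OF near_k] contr[OF near_k] by metis
    then show ?case using IH by simp
  qed
  have ball_iterate: "dist (y k) ystar < \<delta>"
    if "y 0 \<in> ball ystar \<delta>" "ssn_seq \<sigma> \<beta> l lam x y J n" "k \<le> n" for y J n k
  proof -
    have "norm (y k - ystar) \<le> (1 / 2) ^ k * norm (y 0 - ystar)" by (rule iterate[OF that])
    also have "\<dots> \<le> 1 * norm (y 0 - ystar)" by (intro mult_right_mono) (auto simp: power_le_one)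
    finally show ?thesis using that(1) by (simp add: dist_norm norm_minus_commute)
  qed
  have newton: "J k \<in> JF l (y k) \<and> y (Suc k) = y k + inv (J k) (- F (y k))"
    if y0: "y 0 \<in> ball ystar \<delta>" and seq: "\<forall>n. ssn_seq \<sigma> \<beta> l lam x y J n" for y J k
  proof -
    obtain j where j: "J k \<in> JF l (y k)" "ssn_step \<sigma> \<beta> (a_thr l) F (J k) (y k) j (y (Suc k))"
      using seq unfolding ssn_seq_def F_def by blast
    then show ?thesis using step[OF ball_iterate[OF y0 seq[rule_format] order_refl]] by blast
  qed
  have conv: "y \<longlonglongrightarrow> ystar"
    if y0: "y 0 \<in> ball ystar \<delta>" and seq: "\<forall>n. ssn_seq \<sigma> \<beta> l lam x y J n" for y J
  proof -
    have "(\<lambda>k. (1 / 2) ^ k * norm (y 0 - ystar)) \<longlonglongrightarrow> 0"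
      by (intro tendsto_mult_left_zero LIMSEQ_power_zero) simp
    then have "(\<lambda>k. y k - ystar) \<longlonglongrightarrow> 0"
      by (rule Lim_null_comparison[rotated]) (use iterate[OF y0 seq[rule_format] order_refl] in auto)
    then show ?thesis by (simp add: LIM_zero_iff)
  qed
  \<comment> \<open>Since the iterates converge to \<open>ystar\<close>, a one-step estimate valid
    on any neighbourhood, however small, eventually applies to them. Both rates are obtained this
    way.\<close>
  have tail: "\<exists>K. \<forall>k\<ge>K. norm (y (Suc k) - ystar) \<le> e (y k)"
    if y0: "y 0 \<in> ball ystar \<delta>" and seq: "\<forall>n. ssn_seq \<sigma> \<beta> l lam x y J n"
      and ev: "\<forall>\<^sub>F y in nhds ystar. \<forall>J\<in>JF l y. norm (y + inv J (- F y) - ystar) \<le> e y" for y J e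
  proof -
    have "\<forall>\<^sub>F k in sequentially. \<forall>J\<in>JF l (y k). norm (y k + inv J (- F (y k)) - ystar) \<le> e (y k)"
      by (rule eventually_compose_filterlim[OF ev conv[OF y0 seq]])
    then show ?thesis unfolding eventually_sequentially using newton[OF y0 seq] by metis
  qed
  have well_defined: "JF l (y n) \<noteq> {} \<and>
      (\<forall>J'\<in>JF l (y n). \<exists>y'. ssn_step \<sigma> \<beta> (a_thr l) (Fmap l lam x) J' (y n) 0 y')"
    if "y 0 \<in> ball ystar \<delta>" "ssn_seq \<sigma> \<beta> l lam x y J n" for y J n
  proof (intro conjI nonempty ballI)
    fix J' assume "J' \<in> JF l (y n)"
    then show "\<exists>y'. ssn_step \<sigma> \<beta> (a_thr l) (Fmap l lam x) J' (y n) 0 y'"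
      using step[OF ball_iterate[OF that order_refl]] unfolding F_def[symmetric] by simp
  qed
  have superlinear: "\<exists>K. \<forall>k\<ge>K. norm (y (Suc k) - ystar) \<le> \<epsilon> * norm (y k - ystar)"
    if y0: "y 0 \<in> ball ystar \<delta>" and seq: "\<forall>n. ssn_seq \<sigma> \<beta> l lam x y J n" and \<epsilon>: "\<epsilon> > 0" for y J \<epsilon>
  proof (rule tail[OF y0 seq])
    show "\<forall>\<^sub>F y in nhds ystar. \<forall>J\<in>JF l y. norm (y + inv J (- F y) - ystar) \<le> \<epsilon> * norm (y - ystar)"
      using superlin[OF \<epsilon>] by eventually_elim blast
  qed
  have quadratic: "\<exists>C K. \<forall>k\<ge>K. norm (y (Suc k) - ystar) \<le> C * (norm (y k - ystar))\<^sup>2"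
    if y0: "y 0 \<in> ball ystar \<delta>" and seq: "\<forall>n. ssn_seq \<sigma> \<beta> l lam x y J n"
      and strong: "\<forall>z. strongly_semismooth_wrt (Fmap l lam x) (JF l) z" for y J
  proof -
    obtain C r where r: "r > 0" and C: "\<And>h V. norm h < r \<Longrightarrow> V \<in> JF l (ystar + h) \<Longrightarrow>
        norm (F (ystar + h) - F ystar - V h) \<le> C * (norm h)\<^sup>2"
      using strong[rule_format, of ystar] unfolding strongly_semismooth_wrt_def F_def by blast
    have "\<forall>\<^sub>F y in nhds ystar. \<forall>J\<in>JF l y. norm (F y - J (y - ystar)) \<le> C * (norm (y - ystar))\<^sup>2"
      unfolding eventually_nhds_metric
    proof (intro exI[of _ r] conjI r allI impI ballI)
      fix y J assume "dist y ystar < r" "J \<in> JF l y"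
      then show "norm (F y - J (y - ystar)) \<le> C * (norm (y - ystar))\<^sup>2"
        using C[of "y - ystar" J] by (simp add: dist_norm F0)
    qed
    \<comment> \<open>The second-order linearisation error is multiplied by the inverse bound, so
      \<open>c * C\<close> is the quadratic constant.\<close>
    with reg' have "\<forall>\<^sub>F y in nhds ystar. \<forall>J\<in>JF l y.
        norm (y + inv J (- F y) - ystar) \<le> c * (C * (norm (y - ystar))\<^sup>2)"
    proof eventually_elim
      case (elim y)
      then show ?case using newton_step_contracts(2) c less_imp_le by blast
    qed
    then have "\<exists>K. \<forall>k\<ge>K. norm (y (Suc k) - ystar) \<le> c * (C * (norm (y k - ystar))\<^sup>2)"
      by (rule tail[OF y0 seq])
    then show ?thesis by (metis mult.assoc)
  qed
  show ?thesis
  proof (intro exI[of _ \<delta>] conjI[OF \<delta>] allI impI, elim conjE, intro conjI)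
    fix y0 :: "(real ^ 'm) \<times> real" assume y0: "y0 \<in> ball ystar \<delta>"
    show "\<forall>y J n. y 0 = y0 \<and> ssn_seq \<sigma> \<beta> l lam x y J n \<longrightarrow>
          JF l (y n) \<noteq> {} \<and>
          (\<forall>J'\<in>JF l (y n). \<exists>y'. ssn_step \<sigma> \<beta> (a_thr l) (Fmap l lam x) J' (y n) 0 y')"
      using well_defined y0 by metis
    show "\<forall>y J. y 0 = y0 \<and> (\<forall>n. ssn_seq \<sigma> \<beta> l lam x y J n) \<longrightarrow>
          y \<longlonglongrightarrow> ystar \<and>
          (\<forall>\<epsilon>>0. \<exists>K. \<forall>k\<ge>K. norm (y (Suc k) - ystar) \<le> \<epsilon> * norm (y k - ystar))"
      using conv superlinear y0 by metis
    show "(\<forall>z. strongly_semismooth_wrt (Fmap l lam x) (JF l) z) \<longrightarrow>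
      (\<forall>y J. y 0 = y0 \<and> (\<forall>n. ssn_seq \<sigma> \<beta> l lam x y J n) \<longrightarrow>
          (\<exists>C K. \<forall>k\<ge>K. norm (y (Suc k) - ystar) \<le> C * (norm (y k - ystar))\<^sup>2))"
      using quadratic y0 by metis
  qed
qed

end
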